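(* Let $H$ be a finite simple $k$-uniform hypergraph with $k\ge 2$ and $m\ge 1$ edges, and let $K\colon[0,1]^k\to[0,1]$ be a symmetric $k$-uniform hyperkernel. Suppose $a\le K\le 1$ almost everywhere for some $a\in(0,1]$, and put $M:=\log(1/a)$. Then $$\Big\|\log K-\int_{[0,1]^k}\log K\Big\|_2^2\le\frac1m\left(2e^{mM}+m^2M^2\right)M\,\Delta_H(K).$$ Consequently, if $p:=\exp\big(\int_{[0,1]^k}\log K\big)$, then $$\max\left\{\|K-p\|_2^2,\ \|K-p\|_1^2\right\}\le\frac1m\left(2e^{mM}+m^2M^2\right)M\,\Delta_H(K).$$
   Context: A symmetric $k$-uniform hyperkernel is a measurable function $K\colon[0,1]^k\to[0,1]$ invariant under permutations of its coordinates. Integrals are with respect to Lebesgue measure and norms are $L^p$ norms on $[0,1]^k$. For a finite simple $k$-uniform hypergraph $H=(V,E)$ ($E$ a set of $k$-element subsets of the finite set $V$) write $\mathbf{x}_f=(x_v)_{v\in f}$ (in any order) and define $$t(H,K):=\int_{[0,1]^V}\prod_{f\in E}K(\mathbf{x}_f)\prod_{v\in V}dx_v,\qquad r_e^K(\mathbf{x}_e):=\int_{[0,1]^{V\setminus e}}\prod_{f\in E}K(\mathbf{z}_f)\prod_{v\in V\setminus e}dz_v\quad(e\in E),$$ where in the second formula $z_v=x_v$ for $v\in e$. When $t(H,K)>0$ (which holds here since $K\ge a>0$), put $q_e^K:=r_e^K/t(H,K)$ and $$\Delta_H(K):=\sum_{e\in E}\|q_e^K-1\|_{L^1([0,1]^k)}.$$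 *)

theory Defs
  imports "HOL-Analysis.Analysis" "HOL-Combinatorics.Permutations"
begin

text \<open>
  The cube \<open>[0,1]\<^sup>I\<close> with Lebesgue measure, for a finite index set \<open>I\<close>. Its points are the
  functions in \<open>I \<rightarrow>\<^sub>E {0..1}\<close>; the completion makes the measurable sets the Lebesgue
  measurable ones. The cube \<open>[0,1]\<^sup>k\<close> is \<open>unit_cube {..<k}\<close>.
\<close>

definition unit_cube :: "'i set \<Rightarrow> ('i \<Rightarrow> real) measure" where
  "unit_cube I = completion (\<Pi>\<^sub>M i\<in>I. restrict_space lborel {0..1})"

definition Lp_norm :: "'a measure \<Rightarrow> nat \<Rightarrow> ('a \<Rightarrow> real) \<Rightarrow> real" where
  "Lp_norm N p f = root p (LINT x|N. \<bar>f x\<bar> ^ p)"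

definition symmetric_hyperkernel :: "nat \<Rightarrow> ((nat \<Rightarrow> real) \<Rightarrow> real) \<Rightarrow> bool" where
  "symmetric_hyperkernel k K \<longleftrightarrow>
     K \<in> borel_measurable (unit_cube {..<k}) \<and>
     (\<forall>x \<in> space (unit_cube {..<k}). K x \<in> {0..1}) \<and>
     (\<forall>x \<in> space (unit_cube {..<k}). \<forall>\<pi>. \<pi> permutes {..<k} \<longrightarrow> K (x \<circ> \<pi>) = K x)"

definition uniform_hypergraph :: "nat \<Rightarrow> 'v set \<Rightarrow> 'v set set \<Rightarrow> bool" where
  "uniform_hypergraph k V E \<longleftrightarrow> finite V \<and> (\<forall>e\<in>E. e \<subseteq> V \<and> card e = k)"

text \<open>
  The tuple of the coordinates of \<open>x\<close> indexed by \<open>f\<close>. The order is the library's fixed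
  enumeration of the finite set \<open>f\<close>; it does not matter for a symmetric \<open>K\<close>, see
  \<open>symmetric_hyperkernel_tuple\<close> below.
\<close>

definition tuple :: "'v set \<Rightarrow> ('v \<Rightarrow> real) \<Rightarrow> nat \<Rightarrow> real" where
  "tuple f x = (\<lambda>i\<in>{..<card f}. x (from_nat_into f i))"

definition hom_density :: "'v set \<Rightarrow> 'v set set \<Rightarrow> ((nat \<Rightarrow> real) \<Rightarrow> real) \<Rightarrow> real" where
  "hom_density V E K = (LINT x|unit_cube V. (\<Prod>f\<in>E. K (tuple f x)))"

text \<open>
  \<open>edge_marginal V E K e\<close> is \<open>r\<^sub>e\<close> as a function on \<open>[0,1]\<^sup>k\<close>: the argument \<open>y\<close> is
  the tuple \<open>x\<^sub>e\<close>, so the coordinate at \<open>v \<in> e\<close> is the entry of \<open>y\<close> at the position of \<open>v\<close>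
  in the enumeration used by \<open>tuple e\<close>.
\<close>

definition edge_marginal ::
  "'v set \<Rightarrow> 'v set set \<Rightarrow> ((nat \<Rightarrow> real) \<Rightarrow> real) \<Rightarrow> 'v set \<Rightarrow> (nat \<Rightarrow> real) \<Rightarrow> real" where
  "edge_marginal V E K e y =
     (LINT z|unit_cube (V - e).
        (\<Prod>f\<in>E. K (tuple f (\<lambda>v. if v \<in> e then y (to_nat_on e v) else z v))))"

definition normalized_marginal ::
  "'v set \<Rightarrow> 'v set set \<Rightarrow> ((nat \<Rightarrow> real) \<Rightarrow> real) \<Rightarrow> 'v set \<Rightarrow> (nat \<Rightarrow> real) \<Rightarrow> real" where
  "normalized_marginal V E K e y = edge_marginal V E K e y / hom_density V E K"

definition marginal_defect ::
  "nat \<Rightarrow> 'v set \<Rightarrow> 'v set set \<Rightarrow> ((nat \<Rightarrow> real) \<Rightarrow> real) \<Rightarrow> real" where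
  "marginal_defect k V E K =
     (\<Sum>e\<in>E. Lp_norm (unit_cube {..<k}) 1 (\<lambda>y. normalized_marginal V E K e y - 1))"

lemma space_unit_cube: "space (unit_cube I) = I \<rightarrow>\<^sub>E {0..1}"
  by (simp add: unit_cube_def space_PiM space_restrict_space)

lemma symmetric_hyperkernel_tuple:
  assumes K: "symmetric_hyperkernel (card f) K" and f: "finite f"
    and h: "bij_betw h {..<card f} f" and x: "\<And>v. v \<in> f \<Longrightarrow> x v \<in> {0..1}"
  shows "K (\<lambda>i\<in>{..<card f}. x (h i)) = K (tuple f x)"
proof -
  let ?g = "from_nat_into f"
  have g: "bij_betw ?g {..<card f} f"
    using f by (rule bij_betw_from_nat_into_finite)
  define \<pi> where "\<pi> = (\<lambda>i. if i \<in> {..<card f} then (inv_into {..<card f} ?g \<circ> h) i else i)"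
  have "bij_betw (inv_into {..<card f} ?g \<circ> h) {..<card f} {..<card f}"
    using bij_betw_trans[OF h bij_betw_inv_into[OF g]] .
  then have "bij_betw \<pi> {..<card f} {..<card f}"
    by (rule bij_betw_cong[THEN iffD1, rotated]) (simp add: \<pi>_def)
  then have \<pi>: "\<pi> permutes {..<card f}"
    by (rule bij_imp_permutes) (simp add: \<pi>_def)
  have mem: "\<pi> i < card f" "?g (\<pi> i) = h i" if "i < card f" for i
  proof -
    show "\<pi> i < card f" using permutes_in_image[OF \<pi>, of i] that by simp
    have "h i \<in> f" using h that by (auto simp: bij_betw_def)
    then show "?g (\<pi> i) = h i"
      using that bij_betw_inv_into_right[OF g] by (simp add: \<pi>_def)
  qed
  have "tuple f x \<circ> \<pi> = (\<lambda>i\<in>{..<card f}. x (h i))"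
  proof
    fix i show "(tuple f x \<circ> \<pi>) i = (\<lambda>i\<in>{..<card f}. x (h i)) i"
      using mem[of i] by (cases "i < card f") (auto simp: tuple_def \<pi>_def)
  qed
  moreover have "tuple f x \<in> space (unit_cube {..<card f})"
    using x g by (auto simp: space_unit_cube tuple_def bij_betw_def PiE_iff)
  ultimately show ?thesis
    using K \<pi> by (metis symmetric_hyperkernel_def)
qed

end

theory Submission
  imports Defs "HOL-Probability.Infinite_Product_Measure"
begin

text \<open>
  Write \<open>f = ln K\<close>, let \<open>c\<close> be the mean of \<open>f\<close>, and let \<open>W(x)\<close> be the sum of \<open>f(x\<^sub>e)\<close> over the edges \<open>e\<close>, so that
  \<open>exp W\<close> is the product of \<open>K(x\<^sub>e)\<close> over all edges and \<open>-mM \<le> W \<le> 0\<close>. Two measures on \<open>[0,1]\<^sup>V\<close> are compared: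
  the uniform one, and the one with density \<open>exp W / t\<close>, where \<open>t\<close> is the homomorphism density.

  Passing to the tilted measure moves the mean of \<open>f(x\<^sub>e)\<close> by the integral of \<open>(q\<^sub>e - 1) f\<close>, since \<open>q\<^sub>e\<close> is the
  density of \<open>x\<^sub>e\<close> under it (\<open>log_tilt_le_defect\<close>). So it moves the mean of \<open>W\<close> by at most \<open>M \<Delta>\<close>. On the other hand,
  this shift is the covariance of \<open>exp W / t\<close> and \<open>W\<close>, and as \<open>exp\<close> has slope at least \<open>exp (-mM)\<close> on the
  range of \<open>W\<close>, it is at least \<open>exp (-mM)\<close> times the variance of \<open>W\<close> (\<open>variance_le_tilted_mean_diff\<close>).

  Finally, the variance of \<open>W\<close> is at least \<open>m\<close> times that of \<open>f\<close>. Indeed, for two edges \<open>e\<close> and \<open>e'\<close> with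
  intersection \<open>s\<close>, the variables \<open>f(x\<^sub>e)\<close> and \<open>f(x\<^bsub>e'\<^esub>)\<close> are conditionally independent given \<open>x\<^sub>s\<close> and by the
  symmetry of \<open>K\<close> have the same conditional expectation, so that their covariance is nonnegative
  (\<open>edge_correlation_nonneg\<close>). Altogether \<open>m\<close> times the variance of \<open>f\<close> is at most \<open>exp (mM) M \<Delta>\<close>, which is
  stronger than the first claim. The second claim follows because \<open>exp\<close> is a contraction on
  \<open>(-\<infinity>, 0]\<close> and the \<open>L\<^sup>1\<close> norm on a probability space is at most the \<open>L\<^sup>2\<close> norm.

  These arguments use Fubini's theorem for Borel functions and pointwise symmetry, so \<open>K\<close> is first
  replaced by an almost everywhere equal kernel with these properties
  (\<open>obtain_borel_symmetric_kernel\<close>, \<open>marginal_defect_eq\<close>).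
\<close>

section \<open>Cubes and their coordinates\<close>

text \<open>
  Fubini's theorem is available for the product of Borel measures; a product of completed measures
  is not complete. So the argument runs on the cube before completion, and only the statement
  speaks of the completion.
\<close>

definition borel_cube :: "'i set \<Rightarrow> ('i \<Rightarrow> real) measure" where
  "borel_cube I = (\<Pi>\<^sub>M i\<in>I. restrict_space lborel {0..1})"

lemma unit_cube_eq_completion: "unit_cube I = completion (borel_cube I)"
  by (simp add: unit_cube_def borel_cube_def)

lemma space_borel_cube: "space (borel_cube I) = I \<rightarrow>\<^sub>E {0..1}"
  by (simp add: borel_cube_def space_PiM space_restrict_space)

lemma prob_space_unit_interval: "prob_space (restrict_space lborel {0..1::real})"
  by (rule prob_spaceI) (simp add: space_restrict_space emeasure_restrict_space)

lemma prob_space_borel_cube: "prob_space (borel_cube I)"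
  unfolding borel_cube_def by (intro prob_space_PiM prob_space_unit_interval)

lemma product_sigma_finite_unit_interval:
  "product_sigma_finite (\<lambda>i. restrict_space lborel {0..1::real})"
  by (intro product_sigma_finite.intro prob_space_imp_sigma_finite prob_space_unit_interval)

text \<open>
  Measurability of \<open>f\<close> comes for free, since the completion makes every function measurable that
  agrees almost everywhere with a measurable one.
\<close>

lemma integral_completion_AE:
  fixes f g :: "'a \<Rightarrow> real"
  assumes g: "g \<in> borel_measurable M" and eq: "AE x in M. f x = g x"
  shows "(LINT x|completion M. f x) = (LINT x|M. g x)"
proof -
  have "f \<in> borel_measurable (completion M)"
  proof (rule measurableI)
    fix A :: "real set" assume A: "A \<in> sets borel"
    have "{x \<in> space (completion M). g x \<in> A} \<in> sets (completion M)"
      using measurable_sets[OF measurable_completion[OF g] A]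
      by (simp add: vimage_def Int_def conj_commute)
    then have "{x \<in> space (completion M). f x \<in> A} \<in> sets (completion M)"
    proof (rule completion.in_sets_AE[rotated])
      show "AE x in completion M. (x \<in> {x \<in> space (completion M). g x \<in> A}) =
          (x \<in> {x \<in> space (completion M). f x \<in> A})"
        using AE_completion[OF eq] by eventually_elim simp
    qed auto
    then show "f -` A \<inter> space (completion M) \<in> sets (completion M)"
      by (simp add: vimage_def Int_def conj_commute)
  qed simp
  then have "(LINT x|completion M. f x) = (LINT x|completion M. g x)"
    by (rule integral_cong_AE) (use g AE_completion[OF eq] measurable_completion in auto)
  also have "\<dots> = (LINT x|M. g x)"
    using g by (rule integral_completion)
  finally show ?thesis .
qed

lemma measurable_reindex:
  assumes "h \<in> I \<rightarrow> J"
  shows "(\<lambda>x. \<lambda>i\<in>I. x (h i)) \<in> borel_cube J \<rightarrow>\<^sub>M borel_cube I"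
  unfolding borel_cube_def
  using assms by (intro measurable_restrict measurable_component_singleton) auto

lemma distr_reindex:
  assumes "inj_on h I" "h \<in> I \<rightarrow> J"
  shows "distr (borel_cube J) (borel_cube I) (\<lambda>x. \<lambda>i\<in>I. x (h i)) = borel_cube I"
  unfolding borel_cube_def
  by (rule distr_PiM_reindex[OF prob_space_unit_interval assms])

lemma AE_reindex:
  assumes "inj_on h I" "h \<in> I \<rightarrow> J" and "AE y in borel_cube I. P y"
  shows "AE x in borel_cube J. P (\<lambda>i\<in>I. x (h i))"
  using AE_distrD[OF measurable_reindex[OF assms(2)]] distr_reindex[OF assms(1,2)] assms(3)
  by metis

lemma integral_reindex:
  fixes F :: "_ \<Rightarrow> real"
  assumes "inj_on h I" "h \<in> I \<rightarrow> J" and "F \<in> borel_measurable (borel_cube I)"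
  shows "(LINT x|borel_cube J. F (\<lambda>i\<in>I. x (h i))) = (LINT y|borel_cube I. F y)"
  using integral_distr[OF measurable_reindex[OF assms(2)] assms(3)]
    distr_reindex[OF assms(1,2)] by metis

lemma tuple_cong: "(\<And>v. v \<in> f \<Longrightarrow> x v = y v) \<Longrightarrow> tuple f x = tuple f y"
  unfolding tuple_def by (rule restrict_ext) (use from_nat_into[of f] in fastforce)

text \<open>
  If \<open>x\<close> is uniform on the cube of all vertices, then the tuple read off at an edge is uniform on
  \<open>[0,1]\<^sup>k\<close>: the enumeration of the edge is an injective reindexing.
\<close>

lemma
  assumes "finite V" "e \<subseteq> V" "card e = k"
  shows measurable_tuple: "tuple e \<in> borel_cube V \<rightarrow>\<^sub>M borel_cube {..<k}"
    and AE_tuple: "AE y in borel_cube {..<k}. P y \<Longrightarrow> AE x in borel_cube V. P (tuple e x)"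
    and integral_tuple: "F \<in> borel_measurable (borel_cube {..<k}) \<Longrightarrow>
      (LINT x|borel_cube V. F (tuple e x)) = (LINT y|borel_cube {..<k}. F y :: real)"
proof -
  have bij: "bij_betw (from_nat_into e) {..<k} e"
    using bij_betw_from_nat_into_finite[of e] assms finite_subset by auto
  have inj: "inj_on (from_nat_into e) {..<k}" and into: "from_nat_into e \<in> {..<k} \<rightarrow> V"
    using bij assms by (auto simp: bij_betw_def)
  have tup: "tuple e = (\<lambda>x. \<lambda>i\<in>{..<k}. x (from_nat_into e i))"
    using assms by (auto simp: tuple_def fun_eq_iff)
  show "tuple e \<in> borel_cube V \<rightarrow>\<^sub>M borel_cube {..<k}"
    unfolding tup by (rule measurable_reindex[OF into])
  show "AE y in borel_cube {..<k}. P y \<Longrightarrow> AE x in borel_cube V. P (tuple e x)"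
    unfolding tup by (rule AE_reindex[OF inj into])
  show "F \<in> borel_measurable (borel_cube {..<k}) \<Longrightarrow>
      (LINT x|borel_cube V. F (tuple e x)) = (LINT y|borel_cube {..<k}. F y :: real)"
    unfolding tup by (rule integral_reindex[OF inj into])
qed

text \<open>
  The point of the cube over \<open>V\<close> with coordinates \<open>y\<close> on \<open>e\<close>, in the order of the enumeration used by
  \<open>tuple\<close>, and \<open>z\<close> elsewhere. It is the argument in the definition of \<open>edge_marginal\<close> with the
  coordinates outside \<open>V\<close> removed, so that it is measurable into the product space.
\<close>

definition splice :: "'v set \<Rightarrow> 'v set \<Rightarrow> (nat \<Rightarrow> real) \<times> ('v \<Rightarrow> real) \<Rightarrow> 'v \<Rightarrow> real" where
  "splice V e = (\<lambda>(y, z). merge e (V - e) (\<lambda>v\<in>e. y (to_nat_on e v), z))"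

lemma tuple_splice:
  assumes "f \<subseteq> V"
  shows "tuple f (splice V e (y, z)) = tuple f (\<lambda>v. if v \<in> e then y (to_nat_on e v) else z v)"
  using assms by (intro tuple_cong) (auto simp: splice_def merge_def)

lemma tuple_splice_self:
  assumes "finite e" "e \<subseteq> V" "card e = k" "y \<in> space (borel_cube {..<k})"
  shows "tuple e (splice V e (y, z)) = y"
proof
  fix i show "tuple e (splice V e (y, z)) i = y i"
  proof (cases "i < k")
    case True
    then have "from_nat_into e i \<in> e"
      using assms by (auto intro!: from_nat_into)
    moreover have "to_nat_on e (from_nat_into e i) = i"
      using True assms to_nat_on_finite[of e] by (simp add: bij_betw_def)
    ultimately show ?thesis
      using True assms(3) by (simp only: tuple_splice[OF assms(2)]) (simp add: tuple_def)
  next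
    case False
    then show ?thesis
      using assms PiE_arb[of y "{..<k}" _ i] by (simp add: tuple_def space_borel_cube)
  qed
qed

text \<open>
  Splicing is a reindexing of the first component followed by the canonical identification of
  \<open>[0,1]\<^sup>e \<times> [0,1]\<^bsup>V-e\<^esup>\<close> with \<open>[0,1]\<^sup>V\<close>, and both preserve the measure.
\<close>

lemma
  assumes "finite V" "e \<subseteq> V" "card e = k"
  shows measurable_splice:
      "splice V e \<in> borel_cube {..<k} \<Otimes>\<^sub>M borel_cube (V - e) \<rightarrow>\<^sub>M borel_cube V"
    and distr_splice:
      "distr (borel_cube {..<k} \<Otimes>\<^sub>M borel_cube (V - e)) (borel_cube V) (splice V e) = borel_cube V"
proof -
  interpret product_sigma_finite "\<lambda>i. restrict_space lborel {0..1::real}"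
    by (rule product_sigma_finite_unit_interval)
  have fin: "finite e" using assms finite_subset by auto
  have Ve: "e \<union> (V - e) = V" using assms by auto
  let ?r = "\<lambda>y. \<lambda>v\<in>e. y (to_nat_on e v)"
  have bij: "bij_betw (to_nat_on e) e {..<k}"
    using to_nat_on_finite[OF fin] assms by simp
  then have inj: "inj_on (to_nat_on e) e" and into: "to_nat_on e \<in> e \<rightarrow> {..<k}"
    by (auto simp: bij_betw_def)
  have r: "?r \<in> borel_cube {..<k} \<rightarrow>\<^sub>M borel_cube e"
    by (rule measurable_reindex[OF into])
  have id: "distr (borel_cube (V - e)) (borel_cube (V - e)) (\<lambda>z. z) = borel_cube (V - e)"
    by (simp add: distr_id2)
  have pair: "distr (borel_cube {..<k} \<Otimes>\<^sub>M borel_cube (V - e))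
      (borel_cube e \<Otimes>\<^sub>M borel_cube (V - e)) (\<lambda>(y, z). (?r y, z)) =
      borel_cube e \<Otimes>\<^sub>M borel_cube (V - e)"
    using pair_measure_distr[OF r measurable_ident_sets[OF refl], of "borel_cube (V - e)"]
      prob_space_imp_sigma_finite[OF prob_space_borel_cube, of "V - e"]
      distr_reindex[OF inj into] id by (simp add: id_def)
  have rz: "(\<lambda>(y, z). (?r y, z)) \<in> borel_cube {..<k} \<Otimes>\<^sub>M borel_cube (V - e) \<rightarrow>\<^sub>M
      borel_cube e \<Otimes>\<^sub>M borel_cube (V - e)"
    using r by measurable
  have mg: "merge e (V - e) \<in> borel_cube e \<Otimes>\<^sub>M borel_cube (V - e) \<rightarrow>\<^sub>M borel_cube V"
    using measurable_merge[of e "V - e" "\<lambda>_. restrict_space lborel {0..1::real}"]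
    unfolding Ve borel_cube_def .
  have comp: "splice V e = merge e (V - e) \<circ> (\<lambda>(y, z). (?r y, z))"
    by (auto simp: splice_def)
  show "splice V e \<in> borel_cube {..<k} \<Otimes>\<^sub>M borel_cube (V - e) \<rightarrow>\<^sub>M borel_cube V"
    unfolding comp by (rule measurable_comp[OF rz mg])
  have "distr (borel_cube e \<Otimes>\<^sub>M borel_cube (V - e)) (borel_cube V) (merge e (V - e)) = borel_cube V"
    using distr_merge[of e "V - e"] fin assms unfolding Ve borel_cube_def by simp
  then show "distr (borel_cube {..<k} \<Otimes>\<^sub>M borel_cube (V - e)) (borel_cube V) (splice V e) = borel_cube V"
    unfolding comp distr_distr[OF mg rz, symmetric] pair .
qed

lemma
  assumes "finite V" "e \<subseteq> V" "card e = k"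
  shows integral_splice:
      "integrable (borel_cube V) F \<Longrightarrow> (LINT x|borel_cube V. F x :: real) =
        (LINT y|borel_cube {..<k}. LINT z|borel_cube (V - e). F (splice V e (y, z)))"
    and AE_splice:
      "AE x in borel_cube V. P x \<Longrightarrow>
        AE y in borel_cube {..<k}. AE z in borel_cube (V - e). P (splice V e (y, z))"
    and measurable_integral_splice:
      "F \<in> borel_measurable (borel_cube V) \<Longrightarrow>
        (\<lambda>y. LINT z|borel_cube (V - e). F (splice V e (y, z))) \<in> borel_measurable (borel_cube {..<k})"
proof -
  interpret Y: prob_space "borel_cube {..<k}" by (rule prob_space_borel_cube)
  interpret Z: prob_space "borel_cube (V - e)" by (rule prob_space_borel_cube)
  interpret pair_sigma_finite "borel_cube {..<k}" "borel_cube (V - e)" ..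
  note d = distr_splice[OF assms] and [measurable] = measurable_splice[OF assms]
  show "(LINT x|borel_cube V. F x :: real) =
        (LINT y|borel_cube {..<k}. LINT z|borel_cube (V - e). F (splice V e (y, z)))"
    if F: "integrable (borel_cube V) F"
  proof -
    have [measurable]: "F \<in> borel_measurable (borel_cube V)" using F by auto
    have "(LINT x|borel_cube V. F x) =
        (LINT w|(borel_cube {..<k} \<Otimes>\<^sub>M borel_cube (V - e)). F (splice V e w))"
      by (subst d[symmetric], rule integral_distr) measurable
    also have "\<dots> = (LINT y|borel_cube {..<k}. LINT z|borel_cube (V - e). F (splice V e (y, z)))"
      by (rule integral_fst'[symmetric], rule integrable_distr[where M'="borel_cube V"])
        (simp_all add: d F)
    finally show ?thesis .
  qed
  show "AE y in borel_cube {..<k}. AE z in borel_cube (V - e). P (splice V e (y, z))"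
    if "AE x in borel_cube V. P x"
  proof (rule AE_pair)
    have "AE x in distr (borel_cube {..<k} \<Otimes>\<^sub>M borel_cube (V - e)) (borel_cube V) (splice V e). P x"
      using that by (simp only: d)
    then show "AE w in borel_cube {..<k} \<Otimes>\<^sub>M borel_cube (V - e). P (splice V e w)"
      by (rule AE_distrD[OF measurable_splice[OF assms]])
  qed
  show "(\<lambda>y. LINT z|borel_cube (V - e). F (splice V e (y, z))) \<in> borel_measurable (borel_cube {..<k})"
    if [measurable]: "F \<in> borel_measurable (borel_cube V)"
    by measurable
qed

section \<open>Exponential tilting controls the variance\<close>

lemma (in prob_space) integrable_abs_bound:
  fixes f :: "'a \<Rightarrow> real"
  assumes "\<And>x. \<bar>f x\<bar> \<le> B" and "f \<in> borel_measurable M"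
  shows "integrable M f"
  using assms by (intro integrable_const_bound[of f B]) auto

lemma (in prob_space) abs_integral_le_const:
  fixes f :: "'a \<Rightarrow> real"
  assumes "\<And>x. \<bar>f x\<bar> \<le> B"
  shows "\<bar>expectation f\<bar> \<le> B"
proof (cases "integrable M f")
  case True
  have "\<bar>expectation f\<bar> \<le> expectation (\<lambda>x. \<bar>f x\<bar>)" by (rule integral_abs_bound)
  also have "\<dots> \<le> B" using True assms by (intro integral_le_const) auto
  finally show ?thesis .
next
  case False
  then show ?thesis using assms[of undefined] by (simp add: not_integrable_integral_eq)
qed

text \<open>
  With \<open>c\<close> the mean of \<open>W\<close>, the covariance of \<open>exp W\<close> and \<open>W\<close> is the mean of
  \<open>(exp W - exp c) * (W - c)\<close>. On \<open>[-L, 0]\<close> the slope of \<open>exp\<close> is at least \<open>exp (-L)\<close>, so this product is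
  pointwise at least \<open>exp (-L) * (W - c)\<^sup>2\<close>. Dividing the covariance by \<open>t \<le> 1\<close> only enlarges it, and the
  quotient is the shift of the mean of \<open>W\<close> under the density \<open>exp W / t\<close>.
\<close>

lemma (in prob_space) variance_le_tilted_mean_diff:
  fixes W :: "'a \<Rightarrow> real"
  assumes [measurable]: "W \<in> borel_measurable M" and W: "\<And>x. - L \<le> W x" "\<And>x. W x \<le> 0"
  defines "t \<equiv> expectation (\<lambda>x. exp (W x))"
  shows "expectation (\<lambda>x. (W x - expectation W)\<^sup>2) \<le>
    exp L * (expectation (\<lambda>x. exp (W x) * W x) / t - expectation W)"
proof -
  define c where "c = expectation W"
  have absW: "\<bar>W x\<bar> \<le> L" for x using W[of x] by simp
  have int_W: "integrable M W"
    by (rule integrable_const_bound[of _ L]) (simp_all add: absW)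
  have int_e: "integrable M (\<lambda>x. exp (W x))"
    by (rule integrable_const_bound[of _ 1]) (simp_all add: W)
  have int_eW: "integrable M (\<lambda>x. exp (W x) * W x)"
  proof (rule integrable_const_bound[of _ L])
    show "AE x in M. norm (exp (W x) * W x) \<le> L"
      using mult_mono[of "exp (W x)" 1 "\<bar>W x\<bar>" L for x] W absW by (simp add: abs_mult)
  qed measurable
  have L: "0 \<le> L" using W[of undefined] by linarith
  have c: "- L \<le> c" "c \<le> 0"
    using integral_ge_const[OF int_W, of "- L"] integral_le_const[OF int_W, of 0] W
    by (auto simp: c_def)
  have int_sq: "integrable M (\<lambda>x. (W x - c)\<^sup>2)"
  proof (rule integrable_const_bound[of _ "(2 * L)\<^sup>2"])
    have "\<bar>W x - c\<bar> \<le> \<bar>2 * L\<bar>" for x using absW[of x] c L by linarith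
    then show "AE x in M. norm ((W x - c)\<^sup>2) \<le> (2 * L)\<^sup>2"
      by (simp add: abs_le_square_iff)
  qed measurable
  have pw: "exp (- L) * (W x - c)\<^sup>2 \<le> exp (W x) * W x - c * exp (W x) - exp c * (W x - c)" for x
  proof -
    have gap: "exp (- L) * (v - u) \<le> exp v - exp u" if "- L \<le> u" "u \<le> v" for u v :: real
    proof -
      have "exp (- L) * (v - u) \<le> exp u * (v - u)"
        using that by (intro mult_right_mono) auto
      also have "\<dots> \<le> exp u * (exp (v - u) - 1)"
        using exp_ge_add_one_self[of "v - u"] by (intro mult_left_mono) (linarith, simp)
      also have "\<dots> = exp v - exp u"
        by (simp add: algebra_simps flip: exp_add)
      finally show ?thesis .
    qed
    have "exp (- L) * (W x - c) * (W x - c) \<le> (exp (W x) - exp c) * (W x - c)"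
    proof (cases "c \<le> W x")
      case True
      then show ?thesis using gap[of c "W x"] c by (intro mult_right_mono) auto
    next
      case False
      then show ?thesis using gap[of "W x" c] W[of x]
        by (intro mult_right_mono_neg) (auto simp: algebra_simps)
    qed
    then show ?thesis by (simp add: algebra_simps power2_eq_square)
  qed
  have "exp (- L) * expectation (\<lambda>x. (W x - c)\<^sup>2) = expectation (\<lambda>x. exp (- L) * (W x - c)\<^sup>2)"
    by simp
  also have "\<dots> \<le> expectation (\<lambda>x. exp (W x) * W x - c * exp (W x) - exp c * (W x - c))"
    using int_sq int_W int_e int_eW by (intro integral_mono pw) auto
  also have "\<dots> = expectation (\<lambda>x. exp (W x) * W x) - c * t"
    using int_W int_e int_eW by (simp add: t_def c_def prob_space)
  finally have le: "exp (- L) * expectation (\<lambda>x. (W x - c)\<^sup>2) \<le> expectation (\<lambda>x. exp (W x) * W x) - c * t" .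
  have "exp (- L) \<le> t"
    unfolding t_def by (rule integral_ge_const[OF int_e]) (simp add: W)
  then have t0: "0 < t" using exp_gt_zero less_le_trans by blast
  have t1: "t \<le> 1"
    unfolding t_def by (rule integral_le_const[OF int_e]) (simp add: W)
  define d where "d = expectation (\<lambda>x. exp (W x) * W x) / t - c"
  have td: "expectation (\<lambda>x. exp (W x) * W x) - c * t = t * d"
    using t0 by (simp add: d_def field_simps)
  have "0 \<le> exp (- L) * expectation (\<lambda>x. (W x - c)\<^sup>2)" by simp
  with le td t0 have "0 \<le> d" by (metis order_trans zero_le_mult_iff not_less)
  then have "t * d \<le> d" using t1 by (simp add: mult_left_le_one_le t0 less_imp_le)
  with le td have "exp (- L) * expectation (\<lambda>x. (W x - c)\<^sup>2) \<le> d" by linarith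
  then have "exp L * (exp (- L) * expectation (\<lambda>x. (W x - c)\<^sup>2)) \<le> exp L * d"
    by (rule mult_left_mono) simp
  also have "exp L * (exp (- L) * expectation (\<lambda>x. (W x - c)\<^sup>2)) = expectation (\<lambda>x. (W x - c)\<^sup>2)"
    by (simp flip: mult.assoc exp_add)
  finally show ?thesis unfolding c_def d_def .
qed

section \<open>Edges of a hypergraph are nonnegatively correlated\<close>

text \<open>
  A representative of the kernel for which symmetry and the bounds hold at every point and which is
  measurable before completion; the general case is reduced to this one below.
\<close>

locale borel_hyperkernel =
  fixes k :: nat and V :: "'v set" and E :: "'v set set" and K :: "(nat \<Rightarrow> real) \<Rightarrow> real"
    and a :: real
  assumes hypergraph: "uniform_hypergraph k V E"
    and measurable_kernel [measurable]: "K \<in> borel_measurable (borel_cube {..<k})"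
    and lower_pos: "0 < a" and lower: "a \<le> K x" and upper: "K x \<le> 1"
    and symmetric: "\<pi> permutes {..<k} \<Longrightarrow> x \<in> space (borel_cube {..<k}) \<Longrightarrow> K (x \<circ> \<pi>) = K x"
begin

lemma finite_vertices: "finite V"
  using hypergraph by (simp add: uniform_hypergraph_def)

lemma finite_edges: "finite E"
  using hypergraph by (auto simp: uniform_hypergraph_def intro: finite_subset[of E "Pow V"])

lemma edge: "e \<in> E \<Longrightarrow> e \<subseteq> V" "e \<in> E \<Longrightarrow> card e = k"
  using hypergraph by (auto simp: uniform_hypergraph_def)

lemma kernel_reorder:
  assumes "finite e" "card e = k" "bij_betw h {..<k} e" "\<And>v. v \<in> e \<Longrightarrow> x v \<in> {0..1}"
  shows "K (tuple e x) = K (\<lambda>i\<in>{..<k}. x (h i))"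
proof -
  have "K x \<in> {0..1}" for x
    using lower_pos lower[of x] upper[of x] by simp
  then have "symmetric_hyperkernel (card e) K"
    unfolding symmetric_hyperkernel_def unit_cube_eq_completion
    using assms(2) measurable_completion[OF measurable_kernel] symmetric by auto
  from symmetric_hyperkernel_tuple[OF this assms(1)] show ?thesis
    using assms by simp
qed

text \<open>
  The conditional expectation of \<open>g \<circ> K\<close> given the \<open>card s\<close> coordinates \<open>x\<^sub>s\<close>. They are put into the first
  slots of the kernel and the other slots are integrated out; by symmetry this describes the
  conditional expectation for every edge containing \<open>s\<close>.
\<close>

definition shared_marginal :: "(real \<Rightarrow> real) \<Rightarrow> 'v set \<Rightarrow> ('v \<Rightarrow> real) \<Rightarrow> real" where
  "shared_marginal g s x = (LINT w|borel_cube {..<k - card s}.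
     g (K (\<lambda>i\<in>{..<k}. if i < card s then x (from_nat_into s i) else w (i - card s))))"

lemma shared_marginal_cong:
  assumes "\<And>v. v \<in> s \<Longrightarrow> x v = y v"
  shows "shared_marginal g s x = shared_marginal g s y"
proof -
  have "x (from_nat_into s i) = y (from_nat_into s i)" if "i < card s" for i
    using that assms by (metis card.empty from_nat_into not_less_zero)
  then have "(\<lambda>i\<in>{..<k}. if i < card s then x (from_nat_into s i) else w (i - card s)) =
      (\<lambda>i\<in>{..<k}. if i < card s then y (from_nat_into s i) else w (i - card s))" for w :: "nat \<Rightarrow> real"
    by (auto simp: fun_eq_iff)
  then show ?thesis by (simp add: shared_marginal_def)
qed

lemma measurable_shared_arg:
  assumes "s \<subseteq> I"
  shows "(\<lambda>(x, w). \<lambda>i\<in>{..<k}. if i < card s then x (from_nat_into s i) else w (i - card s))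
    \<in> borel_cube I \<Otimes>\<^sub>M borel_cube {..<k - card s} \<rightarrow>\<^sub>M borel_cube {..<k}"
proof -
  let ?P = "borel_cube I \<Otimes>\<^sub>M borel_cube {..<k - card s}"
  have "(\<lambda>p. if i < card s then fst p (from_nat_into s i) else snd p (i - card s))
      \<in> ?P \<rightarrow>\<^sub>M restrict_space lborel {0..1}" if "i < k" for i
  proof (cases "i < card s")
    case True
    then have "from_nat_into s i \<in> s" by (metis card.empty from_nat_into not_less_zero)
    then have "(\<lambda>x. x (from_nat_into s i)) \<in> borel_cube I \<rightarrow>\<^sub>M restrict_space lborel {0..1}"
      unfolding borel_cube_def using assms by (intro measurable_component_singleton) auto
    from measurable_compose[OF measurable_fst this] show ?thesis using True by simp
  next
    case False
    have "(\<lambda>w. w (i - card s)) \<in> borel_cube {..<k - card s} \<rightarrow>\<^sub>M restrict_space lborel {0..1}"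
      unfolding borel_cube_def using that False by (intro measurable_component_singleton) auto
    from measurable_compose[OF measurable_snd this] show ?thesis using False by simp
  qed
  then have "(\<lambda>p. \<lambda>i\<in>{..<k}. if i < card s then fst p (from_nat_into s i) else snd p (i - card s))
      \<in> ?P \<rightarrow>\<^sub>M borel_cube {..<k}"
    unfolding borel_cube_def[of "{..<k}"] by (intro measurable_restrict) auto
  then show ?thesis by (simp add: case_prod_beta)
qed

lemma measurable_shared_marginal:
  assumes "s \<subseteq> I" and [measurable]: "g \<in> borel_measurable borel"
  shows "shared_marginal g s \<in> borel_measurable (borel_cube I)"
proof -
  interpret prob_space "borel_cube {..<k - card s}" by (rule prob_space_borel_cube)
  have "(\<lambda>p. g (K ((\<lambda>(x, w). \<lambda>i\<in>{..<k}. if i < card s then x (from_nat_into s i) else w (i - card s)) p)))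
      \<in> borel_measurable (borel_cube I \<Otimes>\<^sub>M borel_cube {..<k - card s})"
    by (rule measurable_compose[OF measurable_shared_arg[OF assms(1)]]) measurable
  then show ?thesis
    unfolding shared_marginal_def
    by (intro borel_measurable_lebesgue_integral) (simp add: case_prod_beta)
qed

text \<open>
  By symmetry the kernel may read the coordinates in \<open>s\<close> first and those in \<open>e - s\<close> afterwards.
  After this reordering the integral depends neither on the edge \<open>e\<close> nor on the index set
  \<open>J\<close> of the integration, only on \<open>s\<close> and \<open>x\<close>.
\<close>

lemma integral_private_coords:
  assumes "finite e" "card e = k" "s \<subseteq> e" "e - s \<subseteq> J"
    and [measurable]: "g \<in> borel_measurable borel"
    and x: "\<And>v. v \<in> s \<Longrightarrow> x v \<in> {0..1}"
  shows "(LINT z|borel_cube J. g (K (tuple e (\<lambda>v. if v \<in> s then x v else z v)))) = shared_marginal g s x"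
proof -
  let ?j = "card s"
  define h where "h = (\<lambda>i. if i < ?j then from_nat_into s i else from_nat_into (e - s) (i - ?j))"
  have fin: "finite s" "finite (e - s)" using assms finite_subset by auto
  have ck: "card (e - s) = k - ?j" "?j \<le> k"
    using assms card_Diff_subset[OF fin(1)] card_mono by auto
  have bs: "bij_betw (from_nat_into s) {..<?j} s" and be: "bij_betw (from_nat_into (e - s)) {..<k - ?j} (e - s)"
    using bij_betw_from_nat_into_finite[OF fin(1)] bij_betw_from_nat_into_finite[OF fin(2)] ck by auto
  have "bij_betw h {..<?j} s"
    using bs by (rule bij_betw_cong[THEN iffD1, rotated]) (simp add: h_def)
  moreover have "bij_betw h {?j..<k} (e - s)"
  proof -
    have "bij_betw (\<lambda>i. i - ?j) {?j..<k} {..<k - ?j}"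
      by (rule bij_betwI[where g="\<lambda>i. i + ?j"]) auto
    from bij_betw_trans[OF this be] show ?thesis
      by (rule bij_betw_cong[THEN iffD1, rotated]) (simp add: h_def)
  qed
  ultimately have "bij_betw h ({..<?j} \<union> {?j..<k}) (s \<union> (e - s))"
    by (rule bij_betw_combine) auto
  moreover have "{..<?j} \<union> {?j..<k} = {..<k}" "s \<union> (e - s) = e" using ck assms by auto
  ultimately have h: "bij_betw h {..<k} e" by simp
  define F where "F w = g (K (\<lambda>i\<in>{..<k}. if i < ?j then x (from_nat_into s i) else w (i - ?j)))" for w
  have eq: "g (K (tuple e (\<lambda>v. if v \<in> s then x v else z v))) =
      F (\<lambda>i\<in>{..<k - ?j}. z (from_nat_into (e - s) i))" if z: "z \<in> space (borel_cube J)" for z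
  proof -
    have "K (tuple e (\<lambda>v. if v \<in> s then x v else z v)) =
        K (\<lambda>i\<in>{..<k}. (\<lambda>v. if v \<in> s then x v else z v) (h i))"
      using assms h z by (intro kernel_reorder) (auto simp: space_borel_cube PiE_iff)
    also have "(\<lambda>i\<in>{..<k}. (\<lambda>v. if v \<in> s then x v else z v) (h i)) =
        (\<lambda>i\<in>{..<k}. if i < ?j then x (from_nat_into s i)
          else (\<lambda>i\<in>{..<k - ?j}. z (from_nat_into (e - s) i)) (i - ?j))"
    proof (rule restrict_ext)
      fix i assume i: "i \<in> {..<k}"
      have "from_nat_into s i \<in> s" if "i < ?j" using bs that by (auto simp: bij_betw_def)
      moreover have "from_nat_into (e - s) (i - ?j) \<in> e - s" if "\<not> i < ?j"
        using be that i by (auto simp: bij_betw_def)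
      ultimately show "(if h i \<in> s then x (h i) else z (h i)) = (if i < ?j then x (from_nat_into s i)
          else (\<lambda>i\<in>{..<k - ?j}. z (from_nat_into (e - s) i)) (i - ?j))"
        using i by (auto simp: h_def)
    qed
    finally show ?thesis unfolding F_def by (rule arg_cong)
  qed
  have F: "F \<in> borel_measurable (borel_cube {..<k - ?j})"
  proof -
    have r: "restrict x s \<in> space (borel_cube s)" using x by (auto simp: space_borel_cube)
    have "(\<lambda>w. g (K ((\<lambda>(x, w). \<lambda>i\<in>{..<k}. if i < ?j then x (from_nat_into s i) else w (i - ?j)) (restrict x s, w))))
        \<in> borel_measurable (borel_cube {..<k - ?j})"
      by (rule measurable_compose[OF measurable_compose[OF measurable_Pair1'[OF r] measurable_shared_arg[OF subset_refl]]])
        measurable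
    moreover have "F w = g (K ((\<lambda>(x, w). \<lambda>i\<in>{..<k}. if i < ?j then x (from_nat_into s i) else w (i - ?j)) (restrict x s, w)))" for w
    proof -
      have "(\<lambda>i\<in>{..<k}. if i < ?j then x (from_nat_into s i) else w (i - ?j)) =
          (\<lambda>i\<in>{..<k}. if i < ?j then restrict x s (from_nat_into s i) else w (i - ?j))"
        using bs by (auto simp: fun_eq_iff bij_betw_def)
      then show ?thesis by (simp add: F_def)
    qed
    ultimately show ?thesis by presburger
  qed
  have "(LINT z|borel_cube J. g (K (tuple e (\<lambda>v. if v \<in> s then x v else z v)))) =
      (LINT z|borel_cube J. F (\<lambda>i\<in>{..<k - ?j}. z (from_nat_into (e - s) i)))"
    by (rule Bochner_Integration.integral_cong) (simp_all add: eq)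
  also have "\<dots> = (LINT w|borel_cube {..<k - ?j}. F w)"
    using be assms(4) by (intro integral_reindex[OF _ _ F]) (auto simp: bij_betw_def)
  finally show ?thesis by (simp add: F_def shared_marginal_def)
qed

text \<open>
  Given the coordinates shared by \<open>e\<close> and \<open>e'\<close>, the two factors are independent, and both have the
  same conditional expectation by \<open>integral_private_coords\<close>. The integral is thus that of a square.
\<close>

lemma edge_correlation_nonneg:
  fixes g :: "real \<Rightarrow> real"
  assumes "e \<subseteq> V" "card e = k" "e' \<subseteq> V" "card e' = k"
    and [measurable]: "g \<in> borel_measurable borel" and bound: "\<And>x. \<bar>g (K x)\<bar> \<le> B"
  shows "0 \<le> (LINT x|borel_cube V. g (K (tuple e x)) * g (K (tuple e' x)))"
proof -
  interpret product_sigma_finite "\<lambda>i::'v. restrict_space lborel {0..1::real}"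
    by (rule product_sigma_finite_unit_interval)
  interpret V: prob_space "borel_cube V" by (rule prob_space_borel_cube)
  interpret e: prob_space "borel_cube e" by (rule prob_space_borel_cube)
  interpret w: prob_space "borel_cube {..<k - card (e \<inter> e')}" by (rule prob_space_borel_cube)
  let ?s = "e \<inter> e'" and ?\<Phi> = "shared_marginal g (e \<inter> e')"
  have fin: "finite e" "finite e'" "finite (V - e)" using assms finite_vertices finite_subset by auto
  note [measurable] = measurable_tuple[OF finite_vertices assms(1,2)]
    measurable_tuple[OF finite_vertices assms(3,4)] measurable_tuple[OF fin(1) subset_refl assms(2)]
    measurable_shared_marginal[OF Int_lower1 assms(5), of e e']
  have B: "0 \<le> B" using bound[of undefined] by linarith
  have \<Phi>_bound: "\<bar>?\<Phi> x\<bar> \<le> B" for x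
    unfolding shared_marginal_def by (rule w.abs_integral_le_const) (rule bound)
  \<comment> \<open>Integrate first over the coordinates outside \<open>e\<close>, which only \<open>e'\<close> sees, then over \<open>e - s\<close>.\<close>
  have "(LINT x|borel_cube V. g (K (tuple e x)) * g (K (tuple e' x))) =
      (LINT x|borel_cube e. LINT z|borel_cube (V - e).
        g (K (tuple e (merge e (V - e) (x, z)))) * g (K (tuple e' (merge e (V - e) (x, z)))))"
  proof -
    have "integrable (borel_cube V) (\<lambda>x. g (K (tuple e x)) * g (K (tuple e' x)))"
      by (rule V.integrable_const_bound[of _ "B * B"])
        (auto simp: abs_mult intro!: mult_mono bound B)
    moreover have Ve: "e \<union> (V - e) = V" using assms by auto
    ultimately show ?thesis
      using product_integral_fold[of e "V - e" "\<lambda>x. g (K (tuple e x)) * g (K (tuple e' x))"] fin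
      unfolding Ve borel_cube_def by auto
  qed
  also have "\<dots> = (LINT x|borel_cube e. g (K (tuple e x)) * ?\<Phi> x)"
  proof (rule Bochner_Integration.integral_cong[OF refl])
    fix x :: "'v \<Rightarrow> real" assume x: "x \<in> space (borel_cube e)"
    have "tuple e (merge e (V - e) (x, z)) = tuple e x" for z
      by (rule tuple_cong) (simp add: merge_def)
    moreover have "tuple e' (merge e (V - e) (x, z)) = tuple e' (\<lambda>v. if v \<in> ?s then x v else z v)" for z
      using assms by (intro tuple_cong) (auto simp: merge_def)
    moreover have "(LINT z|borel_cube (V - e). g (K (tuple e' (\<lambda>v. if v \<in> ?s then x v else z v)))) = ?\<Phi> x"
      using assms x fin by (intro integral_private_coords) (auto simp: space_borel_cube PiE_iff)
    ultimately show "(LINT z|borel_cube (V - e). g (K (tuple e (merge e (V - e) (x, z)))) *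
        g (K (tuple e' (merge e (V - e) (x, z))))) = g (K (tuple e x)) * ?\<Phi> x"
      by simp
  qed
  also have "\<dots> = (LINT u|borel_cube ?s. LINT z|borel_cube (e - ?s).
      g (K (tuple e (merge ?s (e - ?s) (u, z)))) * ?\<Phi> (merge ?s (e - ?s) (u, z)))"
  proof -
    have "integrable (borel_cube e) (\<lambda>x. g (K (tuple e x)) * ?\<Phi> x)"
      by (rule e.integrable_const_bound[of _ "B * B"])
        (auto simp: abs_mult intro!: mult_mono bound \<Phi>_bound B)
    moreover have es: "?s \<union> (e - ?s) = e" by auto
    ultimately show ?thesis
      using product_integral_fold[of ?s "e - ?s" "\<lambda>x. g (K (tuple e x)) * ?\<Phi> x"] fin
      unfolding es borel_cube_def by auto
  qed
  also have "\<dots> = (LINT u|borel_cube ?s. ?\<Phi> u * ?\<Phi> u)"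
  proof (rule Bochner_Integration.integral_cong[OF refl])
    fix u :: "'v \<Rightarrow> real" assume u: "u \<in> space (borel_cube ?s)"
    have "tuple e (merge ?s (e - ?s) (u, z)) = tuple e (\<lambda>v. if v \<in> ?s then u v else z v)" for z
      by (rule tuple_cong) (auto simp: merge_def)
    moreover have "?\<Phi> (merge ?s (e - ?s) (u, z)) = ?\<Phi> u" for z
      by (rule shared_marginal_cong) (auto simp: merge_def)
    moreover have "(LINT z|borel_cube (e - ?s). g (K (tuple e (\<lambda>v. if v \<in> ?s then u v else z v)))) = ?\<Phi> u"
      using assms u fin by (intro integral_private_coords) (auto simp: space_borel_cube PiE_iff)
    ultimately show "(LINT z|borel_cube (e - ?s). g (K (tuple e (merge ?s (e - ?s) (u, z)))) *
        ?\<Phi> (merge ?s (e - ?s) (u, z))) = ?\<Phi> u * ?\<Phi> u"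
      by simp
  qed
  also have "0 \<le> \<dots>" by (rule Bochner_Integration.integral_nonneg) simp
  finally show ?thesis .
qed


section \<open>The variance of the log-kernel\<close>

text \<open>
  Here \<open>weight\<close> is the integrand of the homomorphism density, and \<open>total_weight\<close> and \<open>marginal e\<close> are the
  Borel counterparts of \<open>t(H,K)\<close> and \<open>r\<^sub>e\<close>; \<open>marginal_defect_eq\<close> below identifies them.
\<close>

definition log_kernel :: "(nat \<Rightarrow> real) \<Rightarrow> real" where
  "log_kernel y = ln (K y)"

definition mean_log :: real where
  "mean_log = (LINT y|borel_cube {..<k}. log_kernel y)"

definition weight :: "('v \<Rightarrow> real) \<Rightarrow> real" where
  "weight x = (\<Prod>f\<in>E. K (tuple f x))"

definition total_weight :: real where
  "total_weight = (LINT x|borel_cube V. weight x)"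

definition marginal :: "'v set \<Rightarrow> (nat \<Rightarrow> real) \<Rightarrow> real" where
  "marginal e y = (LINT z|borel_cube (V - e). weight (splice V e (y, z)))"

lemma kernel_pos: "0 < K x"
  using lower_pos lower[of x] by linarith

lemma log_kernel_bounds: "- ln (1 / a) \<le> log_kernel y" "log_kernel y \<le> 0" "\<bar>log_kernel y\<bar> \<le> ln (1 / a)"
proof -
  show "- ln (1 / a) \<le> log_kernel y"
    using lower[of y] lower_pos kernel_pos[of y] by (simp add: log_kernel_def ln_div)
  moreover show "log_kernel y \<le> 0"
    using upper[of y] kernel_pos[of y] by (simp add: log_kernel_def)
  ultimately show "\<bar>log_kernel y\<bar> \<le> ln (1 / a)" by simp
qed

lemma abs_mult_log_kernel_le: "\<bar>u\<bar> \<le> 1 \<Longrightarrow> \<bar>u * log_kernel y\<bar> \<le> ln (1 / a)"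
  using mult_mono[of "\<bar>u\<bar>" 1 "\<bar>log_kernel y\<bar>" "ln (1 / a)"] log_kernel_bounds(3)[of y]
  by (simp only: abs_mult) simp

lemma measurable_log_kernel [measurable]: "log_kernel \<in> borel_measurable (borel_cube {..<k})"
  unfolding log_kernel_def by measurable

lemma integrable_log_kernel: "integrable (borel_cube {..<k}) log_kernel"
proof -
  interpret prob_space "borel_cube {..<k}" by (rule prob_space_borel_cube)
  show ?thesis
    by (rule integrable_abs_bound[OF log_kernel_bounds(3)]) measurable
qed

lemma mean_log_bounds: "- ln (1 / a) \<le> mean_log" "mean_log \<le> 0"
proof -
  interpret prob_space "borel_cube {..<k}" by (rule prob_space_borel_cube)
  show "- ln (1 / a) \<le> mean_log" "mean_log \<le> 0"
    unfolding mean_log_def using log_kernel_bounds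
    by (auto intro!: integral_ge_const integral_le_const integrable_log_kernel)
qed

lemma log_deviation_bound: "\<bar>log_kernel y - mean_log\<bar> \<le> ln (1 / a)"
  using log_kernel_bounds(1,2)[of y] mean_log_bounds by linarith

lemma measurable_edge_tuple [measurable]: "e \<in> E \<Longrightarrow> tuple e \<in> borel_cube V \<rightarrow>\<^sub>M borel_cube {..<k}"
  by (rule measurable_tuple[OF finite_vertices edge])

lemma measurable_weight [measurable]: "weight \<in> borel_measurable (borel_cube V)"
  unfolding weight_def by measurable

lemma weight_bounds: "0 \<le> weight x" "weight x \<le> 1"
  unfolding weight_def using kernel_pos upper
  by (auto intro!: prod_nonneg prod_le_1 simp: less_imp_le)

lemma weight_eq_exp: "weight x = exp (\<Sum>e\<in>E. log_kernel (tuple e x))"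
  using finite_edges kernel_pos by (simp add: weight_def log_kernel_def exp_sum)

lemma measurable_marginal [measurable]:
  "e \<in> E \<Longrightarrow> marginal e \<in> borel_measurable (borel_cube {..<k})"
  unfolding marginal_def
  by (rule measurable_integral_splice[OF finite_vertices edge measurable_weight])

lemma marginal_bound:
  assumes "e \<in> E"
  shows "\<bar>marginal e y\<bar> \<le> 1"
proof -
  interpret prob_space "borel_cube (V - e)" by (rule prob_space_borel_cube)
  show ?thesis
    unfolding marginal_def by (rule abs_integral_le_const) (use weight_bounds in simp)
qed

lemma integral_weight_edge:
  assumes "e \<in> E"
  shows "(LINT x|borel_cube V. weight x * log_kernel (tuple e x)) =
    (LINT y|borel_cube {..<k}. marginal e y * log_kernel y)"
proof -
  interpret prob_space "borel_cube V" by (rule prob_space_borel_cube)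
  have "integrable (borel_cube V) (\<lambda>x. weight x * log_kernel (tuple e x))"
    using assms weight_bounds by (intro integrable_abs_bound[OF abs_mult_log_kernel_le]) auto
  then have "(LINT x|borel_cube V. weight x * log_kernel (tuple e x)) =
      (LINT y|borel_cube {..<k}. LINT z|borel_cube (V - e).
        weight (splice V e (y, z)) * log_kernel (tuple e (splice V e (y, z))))"
    by (rule integral_splice[OF finite_vertices edge[OF assms]])
  also have "\<dots> = (LINT y|borel_cube {..<k}. marginal e y * log_kernel y)"
    using finite_subset[OF edge(1)[OF assms] finite_vertices] edge[OF assms]
    by (intro Bochner_Integration.integral_cong) (simp_all add: tuple_splice_self marginal_def)
  finally show ?thesis .
qed

text \<open>
  Under the density \<open>weight / total_weight\<close> the tuple at \<open>e\<close> has density \<open>marginal e / total_weight\<close>, so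
  the left-hand side is the integral of \<open>(marginal e / total_weight - 1) * log_kernel\<close>, and
  \<open>\<bar>log_kernel\<bar> \<le> ln (1/a)\<close>.
\<close>

lemma log_tilt_le_defect:
  assumes e: "e \<in> E"
  shows "(LINT x|borel_cube V. weight x * log_kernel (tuple e x)) / total_weight - mean_log \<le>
    ln (1 / a) * (LINT y|borel_cube {..<k}. \<bar>marginal e y / total_weight - 1\<bar>)"
proof -
  interpret prob_space "borel_cube {..<k}" by (rule prob_space_borel_cube)
  note [measurable] = measurable_marginal[OF e]
  have marg: "integrable (borel_cube {..<k}) (marginal e)"
    by (rule integrable_abs_bound[OF marginal_bound[OF e]]) measurable
  have prod: "integrable (borel_cube {..<k}) (\<lambda>y. marginal e y * log_kernel y)"
    by (intro integrable_abs_bound[OF abs_mult_log_kernel_le] marginal_bound[OF e]) measurable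
  have "(LINT x|borel_cube V. weight x * log_kernel (tuple e x)) / total_weight - mean_log =
      (LINT y|borel_cube {..<k}. marginal e y * log_kernel y / total_weight - log_kernel y)"
    using prod integrable_log_kernel by (simp add: integral_weight_edge[OF e] mean_log_def)
  also have "\<dots> \<le> (LINT y|borel_cube {..<k}. ln (1 / a) * \<bar>marginal e y / total_weight - 1\<bar>)"
  proof (rule integral_mono)
    fix y
    have "marginal e y * log_kernel y / total_weight - log_kernel y =
        (marginal e y / total_weight - 1) * log_kernel y"
      by (simp add: field_simps)
    also have "\<dots> \<le> \<bar>marginal e y / total_weight - 1\<bar> * \<bar>log_kernel y\<bar>"
      by (metis abs_ge_self abs_mult)
    also have "\<dots> \<le> \<bar>marginal e y / total_weight - 1\<bar> * ln (1 / a)"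
      by (rule mult_left_mono[OF log_kernel_bounds(3)]) simp
    finally show "marginal e y * log_kernel y / total_weight - log_kernel y \<le>
        ln (1 / a) * \<bar>marginal e y / total_weight - 1\<bar>" by (simp add: mult.commute)
  qed (use prod integrable_log_kernel marg in auto)
  also have "\<dots> = ln (1 / a) * (LINT y|borel_cube {..<k}. \<bar>marginal e y / total_weight - 1\<bar>)"
    by simp
  finally show ?thesis .
qed

text \<open>
  Expand the square: the diagonal terms are copies of the variance of \<open>log_kernel\<close>, and the
  off-diagonal ones are nonnegative.
\<close>

lemma edge_variance_le:
  "real (card E) * (LINT y|borel_cube {..<k}. (log_kernel y - mean_log)\<^sup>2) \<le>
    (LINT x|borel_cube V. (\<Sum>e\<in>E. log_kernel (tuple e x) - mean_log)\<^sup>2)"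
proof -
  interpret prob_space "borel_cube V" by (rule prob_space_borel_cube)
  let ?d = "\<lambda>e x. log_kernel (tuple e x) - mean_log"
  let ?L = "ln (1 / a)"
  have L: "0 \<le> ?L" using log_kernel_bounds[of undefined] by linarith
  have int: "integrable (borel_cube V) (\<lambda>x. ?d e x * ?d e' x)" if "e \<in> E" "e' \<in> E" for e e'
    using that by (intro integrable_abs_bound[of _ "?L * ?L"])
      (auto simp only: abs_mult intro!: mult_mono log_deviation_bound L abs_ge_zero, measurable)
  have nonneg: "0 \<le> (LINT x|borel_cube V. ?d e x * ?d e' x)" if "e \<in> E" "e' \<in> E" for e e'
  proof -
    have "\<bar>(\<lambda>r. ln r - mean_log) (K x)\<bar> \<le> ?L" for x
      using log_deviation_bound[of x] by (simp add: log_kernel_def)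
    then have "0 \<le> (LINT x|borel_cube V.
        (\<lambda>r. ln r - mean_log) (K (tuple e x)) * (\<lambda>r. ln r - mean_log) (K (tuple e' x)))"
      by (intro edge_correlation_nonneg[where B="?L"] edge that) auto
    then show ?thesis by (simp add: log_kernel_def)
  qed
  have "real (card E) * (LINT y|borel_cube {..<k}. (log_kernel y - mean_log)\<^sup>2) =
      (\<Sum>e\<in>E. LINT x|borel_cube V. ?d e x * ?d e x)"
  proof -
    have "(LINT x|borel_cube V. ?d e x * ?d e x) =
        (LINT y|borel_cube {..<k}. (log_kernel y - mean_log)\<^sup>2)" if "e \<in> E" for e
      using integral_tuple[OF finite_vertices edge[OF that], of "\<lambda>y. (log_kernel y - mean_log)\<^sup>2"]
      by (simp add: power2_eq_square)
    then show ?thesis by simp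
  qed
  also have "\<dots> \<le> (\<Sum>e\<in>E. \<Sum>e'\<in>E. LINT x|borel_cube V. ?d e x * ?d e' x)"
    using finite_edges nonneg by (intro sum_mono member_le_sum) auto
  also have "\<dots> = (LINT x|borel_cube V. (\<Sum>e\<in>E. \<Sum>e'\<in>E. ?d e x * ?d e' x))"
    using int by (simp add: Bochner_Integration.integral_sum Bochner_Integration.integrable_sum)
  also have "\<dots> = (LINT x|borel_cube V. (\<Sum>e\<in>E. ?d e x)\<^sup>2)"
    by (simp add: power2_eq_square sum_product)
  finally show ?thesis .
qed

text \<open>
  Tilting is applied to \<open>W\<close>, the sum of \<open>log_kernel\<close> over all edges, because \<open>exp W\<close> is the weight.
\<close>

lemma log_variance_le_defect:
  "real (card E) * (LINT y|borel_cube {..<k}. (log_kernel y - mean_log)\<^sup>2) \<le>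
    exp (real (card E) * ln (1 / a)) * (ln (1 / a) *
      (\<Sum>e\<in>E. LINT y|borel_cube {..<k}. \<bar>marginal e y / total_weight - 1\<bar>))"
proof -
  interpret prob_space "borel_cube V" by (rule prob_space_borel_cube)
  let ?L = "ln (1 / a)"
  define W where "W x = (\<Sum>e\<in>E. log_kernel (tuple e x))" for x
  have W_meas: "W \<in> borel_measurable (borel_cube V)"
    unfolding W_def by measurable
  have W0: "W x \<le> 0" and WL: "- (real (card E) * ?L) \<le> W x" for x
  proof -
    show "W x \<le> 0" unfolding W_def by (rule sum_nonpos) (simp add: log_kernel_bounds)
    have "(\<Sum>e\<in>E. - ?L) \<le> W x" unfolding W_def by (rule sum_mono) (rule log_kernel_bounds)
    then show "- (real (card E) * ?L) \<le> W x" by simp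
  qed
  have int1: "integrable (borel_cube V) (\<lambda>x. log_kernel (tuple e x))" if "e \<in> E" for e
    using that by (intro integrable_abs_bound[OF log_kernel_bounds(3)]) measurable
  have int2: "integrable (borel_cube V) (\<lambda>x. weight x * log_kernel (tuple e x))" if "e \<in> E" for e
    using that weight_bounds by (intro integrable_abs_bound[OF abs_mult_log_kernel_le]) auto
  have W_eq: "W = (\<lambda>x. \<Sum>e\<in>E. log_kernel (tuple e x))"
    by (simp add: W_def fun_eq_iff)
  have mean: "expectation W = real (card E) * mean_log"
    using int1 integral_tuple[OF finite_vertices edge measurable_log_kernel]
    by (simp add: W_eq mean_log_def Bochner_Integration.integral_sum)
  have "real (card E) * (LINT y|borel_cube {..<k}. (log_kernel y - mean_log)\<^sup>2) \<le>
      expectation (\<lambda>x. (W x - expectation W)\<^sup>2)"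
    using edge_variance_le by (simp add: mean) (simp add: W_def sum_subtractf)
  also have "\<dots> \<le> exp (real (card E) * ?L) *
      (expectation (\<lambda>x. exp (W x) * W x) / expectation (\<lambda>x. exp (W x)) - expectation W)"
    by (rule variance_le_tilted_mean_diff[OF W_meas WL W0])
  also have "expectation (\<lambda>x. exp (W x) * W x) / expectation (\<lambda>x. exp (W x)) - expectation W =
      (\<Sum>e\<in>E. expectation (\<lambda>x. weight x * log_kernel (tuple e x)) / total_weight - mean_log)"
  proof -
    have "exp (W x) = weight x" for x by (simp add: W_def weight_eq_exp)
    moreover have "expectation (\<lambda>x. weight x * W x) =
        (\<Sum>e\<in>E. expectation (\<lambda>x. weight x * log_kernel (tuple e x)))"
      using int2 by (simp add: W_def sum_distrib_left Bochner_Integration.integral_sum)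
    ultimately show ?thesis
      by (simp add: mean sum_subtractf sum_divide_distrib total_weight_def)
  qed
  also have "\<dots> \<le> (\<Sum>e\<in>E. ?L * (LINT y|borel_cube {..<k}. \<bar>marginal e y / total_weight - 1\<bar>))"
    by (rule sum_mono) (rule log_tilt_le_defect)
  finally show ?thesis
    by (simp add: sum_distrib_left)
qed

text \<open>
  Both \<open>log_kernel y\<close> and \<open>mean_log\<close> lie in \<open>(-\<infinity>, 0]\<close>, where \<open>exp\<close> is a contraction.
\<close>

lemma kernel_deviation_le:
  "(LINT y|borel_cube {..<k}. (K y - exp mean_log)\<^sup>2) \<le>
    (LINT y|borel_cube {..<k}. (log_kernel y - mean_log)\<^sup>2)"
proof (rule integral_mono)
  interpret prob_space "borel_cube {..<k}" by (rule prob_space_borel_cube)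
  have contract: "\<bar>exp u - exp v\<bar> \<le> \<bar>u - v\<bar>" if "u \<le> 0" "v \<le> 0" for u v :: real
  proof -
    have "exp s - exp r \<le> s - r" if "r \<le> s" "s \<le> 0" for r s :: real
    proof -
      have le: "1 - exp (r - s) \<le> s - r"
        using exp_ge_add_one_self[of "r - s"] by linarith
      have "exp s - exp r = exp s * (1 - exp (r - s))"
        by (simp add: algebra_simps flip: exp_add)
      also have "\<dots> \<le> 1 * (s - r)"
        using that le by (intro mult_mono) auto
      finally show ?thesis by simp
    qed
    from this[of u v] this[of v u] show ?thesis
      using that by (cases "u \<le> v") (auto simp: abs_if)
  qed
  fix y
  have "\<bar>K y - exp mean_log\<bar> \<le> \<bar>log_kernel y - mean_log\<bar>"
    using contract[OF log_kernel_bounds(2)[of y] mean_log_bounds(2)] kernel_pos[of y]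
    by (simp add: log_kernel_def)
  then show "(K y - exp mean_log)\<^sup>2 \<le> (log_kernel y - mean_log)\<^sup>2"
    by (simp add: abs_le_square_iff)
  have L: "0 \<le> ln (1 / a)" using log_kernel_bounds[of undefined] by linarith
  show "integrable (borel_cube {..<k}) (\<lambda>y. (log_kernel y - mean_log)\<^sup>2)"
    using log_deviation_bound L
    by (intro integrable_const_bound[of _ "(ln (1 / a))\<^sup>2"]) (auto simp: abs_le_square_iff[symmetric])
  have "\<bar>K y - exp mean_log\<bar> \<le> 1" for y
    using kernel_pos[of y] upper[of y] mean_log_bounds(2) by (simp add: abs_le_iff) (smt (verit) exp_gt_zero exp_le_one_iff)
  then show "integrable (borel_cube {..<k}) (\<lambda>y. (K y - exp mean_log)\<^sup>2)"
    by (intro integrable_const_bound[of _ 1]) (auto simp: abs_square_le_1)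
qed

end

section \<open>Reduction to Borel kernels\<close>

text \<open>
  A Borel representative \<open>G\<close> of \<open>K\<close> need be symmetric only almost everywhere. Averaging \<open>G\<close> over the finitely
  many permutations makes it symmetric everywhere, and clamping the average to \<open>[a, 1]\<close> makes the
  bounds hold everywhere. Neither step changes the almost everywhere class, because permuting
  coordinates preserves null sets.
\<close>

lemma obtain_borel_symmetric_kernel:
  assumes H: "uniform_hypergraph k V E" and K: "symmetric_hyperkernel k K" and a: "0 < a" "a \<le> 1"
    and bounds: "AE x in unit_cube {..<k}. a \<le> K x \<and> K x \<le> 1"
  obtains K' where "borel_hyperkernel k V E K' a" and "AE x in borel_cube {..<k}. K x = K' x"
proof -
  let ?Q = "borel_cube {..<k}" and ?S = "{\<pi>. \<pi> permutes {..<k}}"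
  have "K \<in> borel_measurable (completion ?Q)"
    using K by (simp add: symmetric_hyperkernel_def unit_cube_eq_completion)
  then obtain G where G[measurable]: "G \<in> borel_measurable ?Q" and KG: "AE x in ?Q. K x = G x"
    using completion_ex_borel_measurable_real by blast
  have fin: "finite ?S" by (rule finite_permutations) simp
  have reorder: "x \<circ> \<pi> = (\<lambda>i\<in>{..<k}. x (\<pi> i))" if "\<pi> permutes {..<k}" "x \<in> space ?Q" for x \<pi>
  proof
    fix i show "(x \<circ> \<pi>) i = (\<lambda>i\<in>{..<k}. x (\<pi> i)) i"
      using that permutes_not_in[OF that(1), of i] PiE_arb[of x "{..<k}" _ i]
      by (cases "i < k") (auto simp: space_borel_cube)
  qed
  have into: "\<pi> \<in> {..<k} \<rightarrow> {..<k}" if "\<pi> permutes {..<k}" for \<pi>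
    using permutes_in_image[OF that] by auto
  have inj: "inj_on \<pi> {..<k}" if "\<pi> permutes {..<k}" for \<pi>
    using permutes_inj_on[OF that] .
  define A where "A x = (\<Sum>\<pi>\<in>?S. G (x \<circ> \<pi>)) / card ?S" for x
  define K' where "K' x = max a (min 1 (A x))" for x
  have G_reorder: "(\<lambda>x. G (x \<circ> \<pi>)) \<in> borel_measurable ?Q" if "\<pi> \<in> ?S" for \<pi>
  proof -
    have "(\<lambda>x. G (\<lambda>i\<in>{..<k}. x (\<pi> i))) \<in> borel_measurable ?Q"
      using that by (intro measurable_compose[OF measurable_reindex[OF into] G]) simp
    then show ?thesis
      using that by (subst measurable_cong[OF arg_cong[where f=G, OF reorder]]) auto
  qed
  have A_meas[measurable]: "A \<in> borel_measurable ?Q"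
    unfolding A_def using G_reorder by (intro borel_measurable_divide borel_measurable_sum) auto
  show ?thesis
  proof (rule that)
    have "K' (x \<circ> \<rho>) = K' x" if "\<rho> permutes {..<k}" "x \<in> space ?Q" for \<rho> x
    proof -
      have "(\<Sum>\<pi>\<in>?S. G (x \<circ> \<pi>)) = (\<Sum>\<pi>\<in>?S. G (x \<circ> (\<rho> \<circ> \<pi>)))"
        by (rule setum_permutations_compose_left[OF that(1)])
      then show ?thesis by (simp add: K'_def A_def comp_assoc)
    qed
    moreover have "K' \<in> borel_measurable ?Q" unfolding K'_def by measurable
    moreover have "a \<le> K' x" "K' x \<le> 1" for x using a by (auto simp: K'_def)
    ultimately show "borel_hyperkernel k V E K' a"
      using H a by unfold_locales
    have "AE x in ?Q. \<forall>\<pi>\<in>?S. K (\<lambda>i\<in>{..<k}. x (\<pi> i)) = G (\<lambda>i\<in>{..<k}. x (\<pi> i))"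
      using AE_reindex[OF inj into KG] by (intro AE_finite_allI[OF fin]) simp
    moreover have "AE x in ?Q. a \<le> K x \<and> K x \<le> 1"
      using bounds unfolding unit_cube_eq_completion AE_completion_iff .
    moreover have "AE x in ?Q. x \<in> space ?Q" by (rule AE_space)
    ultimately show "AE x in ?Q. K x = K' x"
    proof eventually_elim
      case (elim x)
      have "G (x \<circ> \<pi>) = K x" if "\<pi> \<in> ?S" for \<pi>
      proof -
        have "K (x \<circ> \<pi>) = K x"
          using K elim that by (simp add: symmetric_hyperkernel_def unit_cube_eq_completion)
        then show ?thesis using elim that reorder[of \<pi> x] by simp
      qed
      moreover have "card ?S > 0" using fin by (auto simp: card_gt_0_iff intro: permutes_id)
      ultimately have "A x = K x" by (simp add: A_def)
      then show ?case using elim by (simp add: K'_def)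
    qed
  qed
qed

lemma
  fixes f g :: "'a \<Rightarrow> real"
  assumes [measurable]: "g \<in> borel_measurable M" and eq: "AE x in M. f x = g x"
  shows Lp_norm_1_completion: "Lp_norm (completion M) 1 f = (LINT x|M. \<bar>g x\<bar>)"
    and Lp_norm_2_completion: "(Lp_norm (completion M) 2 f)\<^sup>2 = (LINT x|M. (g x)\<^sup>2)"
proof -
  have power: "(LINT x|completion M. \<bar>f x\<bar> ^ p) = (LINT x|M. \<bar>g x\<bar> ^ p)" for p :: nat
  proof (rule integral_completion_AE)
    show "AE x in M. \<bar>f x\<bar> ^ p = \<bar>g x\<bar> ^ p" using eq by eventually_elim simp
  qed measurable
  show "Lp_norm (completion M) 1 f = (LINT x|M. \<bar>g x\<bar>)"
    using power[of 1] by (simp add: Lp_norm_def)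
  show "(Lp_norm (completion M) 2 f)\<^sup>2 = (LINT x|M. (g x)\<^sup>2)"
    using power[of 2] by (simp add: Lp_norm_def)
qed

text \<open>
  Changing the kernel on a null set changes the weight on a null set, as every edge tuple is
  uniformly distributed. By Fubini, for almost every \<open>y\<close> it then changes the integrand of
  \<open>edge_marginal\<close> at \<open>y\<close> on a null set only.
\<close>

lemma (in borel_hyperkernel) marginal_defect_eq:
  assumes eq: "AE y in borel_cube {..<k}. J y = K y"
  shows "marginal_defect k V E J =
    (\<Sum>e\<in>E. LINT y|borel_cube {..<k}. \<bar>marginal e y / total_weight - 1\<bar>)"
proof -
  have weight: "AE x in borel_cube V. (\<Prod>f\<in>E. J (tuple f x)) = weight x"
  proof -
    have "AE x in borel_cube V. \<forall>f\<in>E. J (tuple f x) = K (tuple f x)"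
      using AE_tuple[OF finite_vertices edge eq] by (intro AE_finite_allI[OF finite_edges])
    then show ?thesis by eventually_elim (simp add: weight_def)
  qed
  have density: "hom_density V E J = total_weight"
    unfolding hom_density_def total_weight_def unit_cube_eq_completion
    by (rule integral_completion_AE[OF measurable_weight weight])
  have marg: "AE y in borel_cube {..<k}. edge_marginal V E J e y = marginal e y" if e: "e \<in> E" for e
  proof -
    have "AE y in borel_cube {..<k}. AE z in borel_cube (V - e).
        (\<Prod>f\<in>E. J (tuple f (splice V e (y, z)))) = weight (splice V e (y, z))"
      by (rule AE_splice[OF finite_vertices edge[OF e] weight])
    moreover have "AE y in borel_cube {..<k}. y \<in> space (borel_cube {..<k})" by (rule AE_space)
    ultimately show ?thesis
    proof eventually_elim
      case (elim y)
      have "(\<lambda>z. splice V e (y, z)) \<in> borel_cube (V - e) \<rightarrow>\<^sub>M borel_cube V"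
        using measurable_compose[OF measurable_Pair1'[OF elim(2)]
          measurable_splice[OF finite_vertices edge[OF e]]] by simp
      then have "(\<lambda>z. weight (splice V e (y, z))) \<in> borel_measurable (borel_cube (V - e))"
        by measurable
      from integral_completion_AE[OF this elim(1)]
      show ?case
        unfolding edge_marginal_def marginal_def unit_cube_eq_completion
        using edge by (simp add: tuple_splice)
    qed
  qed
  have "Lp_norm (unit_cube {..<k}) 1 (\<lambda>y. normalized_marginal V E J e y - 1) =
      (LINT y|borel_cube {..<k}. \<bar>marginal e y / total_weight - 1\<bar>)" if e: "e \<in> E" for e
    unfolding unit_cube_eq_completion normalized_marginal_def density
  proof (rule Lp_norm_1_completion)
    show "AE y in borel_cube {..<k}. edge_marginal V E J e y / total_weight - 1 = marginal e y / total_weight - 1"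
      using marg[OF e] by eventually_elim simp
  qed (use e in measurable)
  then show ?thesis by (simp add: marginal_defect_def)
qed

section \<open>The stability estimate\<close>

theorem theorem4p3:
  fixes k m :: nat and V :: "'v set" and E :: "'v set set"
    and K :: "(nat \<Rightarrow> real) \<Rightarrow> real" and a M p :: real
  assumes "k \<ge> 2"
    and "uniform_hypergraph k V E"
    and "m = card E" and "m \<ge> 1"
    and "symmetric_hyperkernel k K"
    and "0 < a" and "a \<le> 1"
    and "AE x in unit_cube {..<k}. a \<le> K x \<and> K x \<le> 1"
    and "M = ln (1 / a)"
    and "p = exp (LINT x|unit_cube {..<k}. ln (K x))"
  shows "(Lp_norm (unit_cube {..<k}) 2
            (\<lambda>x. ln (K x) - (LINT y|unit_cube {..<k}. ln (K y))))\<^sup>2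
          \<le> 1 / real m * (2 * exp (real m * M) + (real m)\<^sup>2 * M\<^sup>2) * M * marginal_defect k V E K
       \<and> max ((Lp_norm (unit_cube {..<k}) 2 (\<lambda>x. K x - p))\<^sup>2)
             ((Lp_norm (unit_cube {..<k}) 1 (\<lambda>x. K x - p))\<^sup>2)
          \<le> 1 / real m * (2 * exp (real m * M) + (real m)\<^sup>2 * M\<^sup>2) * M * marginal_defect k V E K"
proof -
  let ?Q = "borel_cube {..<k}"
  obtain K' where K': "borel_hyperkernel k V E K' a" and eq: "AE x in ?Q. K x = K' x"
    by (rule obtain_borel_symmetric_kernel[OF assms(2,5-8)])
  interpret B: borel_hyperkernel k V E K' a by (rule K')
  interpret prob_space ?Q by (rule prob_space_borel_cube)
  note [measurable] = B.measurable_kernel B.measurable_log_kernel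
  define dev where "dev = (LINT y|?Q. (B.log_kernel y - B.mean_log)\<^sup>2)"
  define D where "D = marginal_defect k V E K"
  have D: "D = (\<Sum>e\<in>E. LINT y|?Q. \<bar>B.marginal e y / B.total_weight - 1\<bar>)"
    unfolding D_def by (rule B.marginal_defect_eq[OF eq])
  have D0: "0 \<le> D" unfolding D by (intro sum_nonneg Bochner_Integration.integral_nonneg) simp
  have M0: "0 \<le> M" using assms(6,7,9) by simp
  have log_eq: "AE y in ?Q. ln (K y) = B.log_kernel y"
    using eq by eventually_elim (simp add: B.log_kernel_def)
  have mean: "(LINT y|unit_cube {..<k}. ln (K y)) = B.mean_log"
    unfolding unit_cube_eq_completion B.mean_log_def
    by (rule integral_completion_AE[OF B.measurable_log_kernel log_eq])
  have p: "p = exp B.mean_log" using assms(10) mean by simp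
  have "real m * dev \<le> exp (real m * M) * (M * D)"
    using B.log_variance_le_defect unfolding dev_def D assms(3,9) .
  \<comment> \<open>The argument yields the constant \<open>exp (m M)\<close>, which is below the one claimed.\<close>
  also have "\<dots> \<le> (2 * exp (real m * M) + (real m)\<^sup>2 * M\<^sup>2) * (M * D)"
    using M0 D0 by (intro mult_right_mono) auto
  finally have dev_le: "dev \<le> 1 / real m * (2 * exp (real m * M) + (real m)\<^sup>2 * M\<^sup>2) * M * D"
    using assms(4) by (simp add: field_simps)
  have log_norm: "(Lp_norm (unit_cube {..<k}) 2 (\<lambda>x. ln (K x) - (LINT y|unit_cube {..<k}. ln (K y))))\<^sup>2 = dev"
    unfolding mean unfolding unit_cube_eq_completion dev_def
  proof (rule Lp_norm_2_completion)
    show "AE x in ?Q. ln (K x) - B.mean_log = B.log_kernel x - B.mean_log"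
      using log_eq by eventually_elim simp
  qed measurable
  have diff: "AE x in ?Q. K x - p = K' x - p"
    using eq by eventually_elim simp
  have norm2: "(Lp_norm (unit_cube {..<k}) 2 (\<lambda>x. K x - p))\<^sup>2 = (LINT x|?Q. (K' x - p)\<^sup>2)"
    unfolding unit_cube_eq_completion by (rule Lp_norm_2_completion[OF _ diff]) measurable
  have norm1: "Lp_norm (unit_cube {..<k}) 1 (\<lambda>x. K x - p) = (LINT x|?Q. \<bar>K' x - p\<bar>)"
    unfolding unit_cube_eq_completion by (rule Lp_norm_1_completion[OF _ diff]) measurable
  have le2: "(LINT x|?Q. (K' x - p)\<^sup>2) \<le> dev"
    unfolding p dev_def by (rule B.kernel_deviation_le)
  \<comment> \<open>The variance of \<open>\<bar>K' - p\<bar>\<close> is nonnegative.\<close>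
  have le1: "(LINT x|?Q. \<bar>K' x - p\<bar>)\<^sup>2 \<le> (LINT x|?Q. (K' x - p)\<^sup>2)"
  proof -
    have bound: "\<bar>K' x - p\<bar> \<le> 1 + \<bar>p\<bar>" for x
      using B.kernel_pos[of x] B.upper[of x] by linarith
    have "integrable ?Q (\<lambda>x. \<bar>K' x - p\<bar>)"
      using bound by (intro integrable_abs_bound[of _ "1 + \<bar>p\<bar>"]) auto
    moreover have "integrable ?Q (\<lambda>x. \<bar>K' x - p\<bar>\<^sup>2)"
      using power_mono[OF bound abs_ge_zero, where n=2] by (intro integrable_abs_bound[of _ "(1 + \<bar>p\<bar>)\<^sup>2"]) auto
    ultimately show ?thesis
      using variance_eq[of "\<lambda>x. \<bar>K' x - p\<bar>"] variance_positive[of "\<lambda>x. \<bar>K' x - p\<bar>"] by simp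
  qed
  show ?thesis
    using dev_le le1 le2 unfolding log_norm norm1 norm2 D_def by simp
qed

end
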